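(* Let $V$ be a locally convex topological vector space, and let $C$ be a closed and convex subset of $V$. Given a point $p\in C$ and a vector $v\in V$, there exists a continuous curve $c\colon[0,+\infty)\to C$ such that $c(0)=p$ and $$\left.\frac{dc(t)}{dt}\right|_{t=0+}=v$$ if, and only if, $v$ is in the sequential closure of the tangent cone of $C$ at $p$.
   Context: Vector spaces are real; $V^*$ denotes the topological dual of $V$. The tangent cone of a convex set $C\subseteq V$ at $p\in C$ is the set of vectors $w\in V$ such that $p+tw\in C$ for some $t>0$, i.e. the set $\mathbb{R}_{>0}(C-p)$. The solid tangent cone of $C$ at $p$ is the set of vectors $w\in V$ such that $\theta(w)\geq 0$ for every $\theta\in V^*$ that is nonnegative on $C-p$. The sequential closure of the tangent cone of $C$ at $p$ is the set of vectors $w$ in the solid tangent cone of $C$ at $p$ for which there is a sequence $(w_i)_{i\geq1}$ in the tangent cone of $C$ at $p$ with $w_i\to w$ as $i\to\infty$. The one-sided derivative is $\left.\frac{dc(t)}{dt}\right|_{t=0+}=\lim_{t\to0+}\frac{c(t)-p}{t}$, the limit being taken in the topology of $V$. *)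

theory Defs
  imports "HOL-Analysis.Analysis"
begin

text \<open>
  Real topological vector spaces. As in the library's hierarchy of topological groups, no
  separation axiom is imposed: the spaces need not be Hausdorff.
\<close>

class topological_real_vector = topological_ab_group_add + real_vector +
  assumes tendsto_scaleR_Pair:
    "LIM x (nhds r \<times>\<^sub>F nhds a). fst x *\<^sub>R snd x :> nhds (r *\<^sub>R a)"

text \<open>
  The last conjunct is the definition of \<open>convex W\<close>, unfolded: the constant \<open>convex\<close> is defined
  outside the class context and cannot be used in a class axiom.
\<close>

class locally_convex_vector = topological_real_vector +
  assumes convex_neighbourhood_base_raw:
    "open U \<Longrightarrow> 0 \<in> U \<Longrightarrow> \<exists>W. open W \<and> 0 \<in> W \<and> W \<subseteq> U \<and>
      (\<forall>x\<in>W. \<forall>y\<in>W. \<forall>u\<ge>0. \<forall>v\<ge>0. u + v = 1 \<longrightarrow> u *\<^sub>R x + v *\<^sub>R y \<in> W)"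

lemma convex_neighbourhood_base:
  fixes U :: "'a::locally_convex_vector set"
  assumes "open U" "0 \<in> U"
  shows "\<exists>W. open W \<and> 0 \<in> W \<and> W \<subseteq> U \<and> convex W"
  unfolding convex_def by (rule convex_neighbourhood_base_raw[OF assms])

instance real_normed_vector \<subseteq> locally_convex_vector
proof
  fix r :: real and a :: 'a
  have "((\<lambda>x::real \<times> 'a. fst x *\<^sub>R snd x) \<longlongrightarrow> fst (r, a) *\<^sub>R snd (r, a)) (nhds (r, a))"
    by (intro tendsto_scaleR tendsto_fst tendsto_snd filterlim_ident)
  then show "LIM x (nhds r \<times>\<^sub>F nhds a). fst x *\<^sub>R snd x :> nhds (r *\<^sub>R a)"
    by (simp add: nhds_prod)
next
  fix U :: "'a set"
  assume "open U" "0 \<in> U"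
  then obtain e where "e > 0" "ball 0 e \<subseteq> U"
    by (auto simp: open_contains_ball)
  then have "open (ball 0 e :: 'a set) \<and> 0 \<in> (ball 0 e :: 'a set) \<and> ball 0 e \<subseteq> U \<and>
      convex (ball 0 e :: 'a set)"
    by simp
  then show "\<exists>W. open W \<and> 0 \<in> W \<and> W \<subseteq> U \<and>
      (\<forall>x\<in>W. \<forall>y\<in>W. \<forall>u\<ge>0. \<forall>v\<ge>0. u + v = 1 \<longrightarrow> u *\<^sub>R x + v *\<^sub>R y \<in> W)"
    unfolding convex_def by blast
qed

definition topological_dual :: "('a::topological_real_vector \<Rightarrow> real) set" where
  "topological_dual = {\<theta>. linear \<theta> \<and> continuous_on UNIV \<theta>}"

definition tangent_cone :: "'a::real_vector set \<Rightarrow> 'a \<Rightarrow> 'a set" where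
  "tangent_cone C p = {w. \<exists>t>0. p + t *\<^sub>R w \<in> C}"

definition solid_tangent_cone :: "'a::topological_real_vector set \<Rightarrow> 'a \<Rightarrow> 'a set" where
  "solid_tangent_cone C p =
    {w. \<forall>\<theta>\<in>topological_dual. (\<forall>x\<in>C. \<theta> (x - p) \<ge> 0) \<longrightarrow> \<theta> w \<ge> 0}"

definition seq_closure_tangent_cone :: "'a::topological_real_vector set \<Rightarrow> 'a \<Rightarrow> 'a set" where
  "seq_closure_tangent_cone C p =
    {w \<in> solid_tangent_cone C p. \<exists>ws. (\<forall>i. ws i \<in> tangent_cone C p) \<and> ws \<longlonglongrightarrow> w}"

text \<open>
  The library's \<open>has_vector_derivative\<close> is restricted to normed spaces. In a space that is not
  Hausdorff, the predicate says that \<open>v\<close> is a limit of the difference quotients.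
\<close>

definition has_right_derivative_at_0 ::
    "(real \<Rightarrow> 'a::topological_real_vector) \<Rightarrow> 'a \<Rightarrow> bool" where
  "has_right_derivative_at_0 c v \<longleftrightarrow>
    ((\<lambda>t. (c t - c 0) /\<^sub>R t) \<longlongrightarrow> v) (at_right 0)"

end

theory Submission
  imports Defs
begin

text \<open>
  A curve with right derivative \<open>v\<close> gives the difference quotients
  \<open>(n + 1) *\<^sub>R (c (1 / (n + 1)) - p)\<close>. They lie in the tangent cone and converge to \<open>v\<close>, and
  continuous functionals pass to the limit, so \<open>v\<close> lies in the sequential closure.

  Conversely let \<open>w n \<longlonglongrightarrow> v\<close> with every \<open>w n\<close> in the tangent cone. The natural curve is
  \<open>c t = p + t *\<^sub>R \<omega> (1 / t - 1)\<close>, where \<open>\<omega>\<close> interpolates \<open>w 0, w 1, \<dots>\<close> linearly: its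
  difference quotient at \<open>t\<close> is a convex combination of two consecutive members of the sequence
  with large index, and it tends to \<open>v\<close> because neighbourhoods of \<open>v\<close> contain convex ones
  (\<open>tendsto_linear_interpolation\<close>). The curve stays in \<open>C\<close> provided that the segment from \<open>p\<close> in
  direction \<open>w n\<close> remains in \<open>C\<close> up to time about \<open>1 / n\<close>. In general the lengths of these
  segments may shrink arbitrarily fast. This is cured by repeating each term of the sequence often
  enough: a vector of the tangent cone is admissible from some index onwards, and
  \<open>delayed_sequence\<close> makes the sequence wait for it.
\<close>

section \<open>Continuity of the vector operations\<close>

lemma tendsto_scaleR_tvs:
  fixes g :: "'b \<Rightarrow> 'a::topological_real_vector"
  assumes "(f \<longlongrightarrow> r) F" and "(g \<longlongrightarrow> a) F"
  shows "((\<lambda>x. f x *\<^sub>R g x) \<longlongrightarrow> r *\<^sub>R a) F"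
  using filterlim_compose[OF tendsto_scaleR_Pair filterlim_Pair[OF assms]] by simp

lemma continuous_on_scaleR_tvs:
  fixes g :: "'b::topological_space \<Rightarrow> 'a::topological_real_vector"
  assumes "continuous_on S f" and "continuous_on S g"
  shows "continuous_on S (\<lambda>x. f x *\<^sub>R g x)"
  using assms unfolding continuous_on_def by (auto intro: tendsto_scaleR_tvs)

section \<open>Directions that remain in a convex set up to a given time\<close>

lemma tangent_coneD:
  assumes "convex C" "p \<in> C" "w \<in> tangent_cone C p"
  obtains r where "r > 0" "\<And>s. 0 \<le> s \<Longrightarrow> s \<le> r \<Longrightarrow> p + s *\<^sub>R w \<in> C"
proof -
  obtain r where r: "r > 0" "p + r *\<^sub>R w \<in> C"
    using assms(3) by (auto simp: tangent_cone_def)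
  have "p + s *\<^sub>R w \<in> C" if "0 \<le> s" "s \<le> r" for s
  proof -
    have "(1 - s / r) *\<^sub>R p + (s / r) *\<^sub>R (p + r *\<^sub>R w) \<in> C"
      using assms(1,2) r that by (intro convexD) auto
    moreover have "(1 - s / r) *\<^sub>R p + (s / r) *\<^sub>R (p + r *\<^sub>R w) = p + s *\<^sub>R w"
      using r by (simp add: scaleR_left_diff_distrib scaleR_right_distrib)
    ultimately show ?thesis by simp
  qed
  with r that show ?thesis by blast
qed

text \<open>
  The set of directions along which one can leave \<open>p\<close> and stay in \<open>C\<close> up to time
  \<open>min 1 (1 / n)\<close>; writing the bound as a product gives \<open>n = 0\<close> the time \<open>1\<close>.
\<close>

definition admissible_directions :: "'a::real_vector set \<Rightarrow> 'a \<Rightarrow> nat \<Rightarrow> 'a set" where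
  "admissible_directions C p n = {w. \<forall>s. 0 \<le> s \<and> s \<le> 1 \<and> s * real n \<le> 1 \<longrightarrow> p + s *\<^sub>R w \<in> C}"

lemma eventually_admissible:
  assumes "convex C" "p \<in> C" "w \<in> tangent_cone C p"
  shows "\<forall>\<^sub>F n in sequentially. w \<in> admissible_directions C p n"
proof -
  obtain r where r: "r > 0" "\<And>s. 0 \<le> s \<Longrightarrow> s \<le> r \<Longrightarrow> p + s *\<^sub>R w \<in> C"
    using tangent_coneD[OF assms] by blast
  obtain N where N: "1 / r < real N"
    using reals_Archimedean2 by blast
  have "w \<in> admissible_directions C p n" if "n \<ge> N" for n
    unfolding admissible_directions_def
  proof (intro CollectI allI impI)
    fix s :: real
    assume s: "0 \<le> s \<and> s \<le> 1 \<and> s * real n \<le> 1"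
    have "1 / r \<le> real n"
      using N that by linarith
    then have "s * (1 / r) \<le> s * real n"
      using s by (intro mult_left_mono) auto
    also have "\<dots> \<le> 1"
      using s by simp
    finally have "s \<le> r"
      using r(1) by (simp add: field_simps)
    then show "p + s *\<^sub>R w \<in> C"
      using s r(2) by blast
  qed
  then show ?thesis
    by (auto simp: eventually_sequentially)
qed

text \<open>
  Delaying a sequence: if every term is eventually admissible, with index \<open>0\<close> admissible at all
  times, then using at time \<open>n\<close> the largest admissible index up to \<open>n\<close> keeps every term
  admissible while the indices still tend to infinity.
\<close>

lemma delayed_sequence:
  fixes P :: "nat \<Rightarrow> nat \<Rightarrow> bool"
  assumes "\<And>k. \<forall>\<^sub>F n in sequentially. P k n" and "\<And>n. P 0 n"
  obtains f where "filterlim f at_top sequentially" "\<And>n. P (f n) n"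
proof
  define f where "f n = Max {k. k \<le> n \<and> P k n}" for n
  have fin: "finite {k. k \<le> n \<and> P k n}" for n
    by simp
  have "f n \<in> {k. k \<le> n \<and> P k n}" for n
    unfolding f_def using assms(2) by (intro Max_in[OF fin]) auto
  then show "P (f n) n" for n
    by simp
  show "filterlim f at_top sequentially"
    unfolding filterlim_at_top
  proof
    fix K
    show "\<forall>\<^sub>F n in sequentially. K \<le> f n"
      using assms(1)[of K] eventually_ge_at_top[of K]
      by eventually_elim (auto simp: f_def intro: Max_ge[OF fin])
  qed
qed

section \<open>Linear interpolation of a sequence\<close>

definition linear_interpolation :: "(nat \<Rightarrow> 'a::real_vector) \<Rightarrow> real \<Rightarrow> 'a" where
  "linear_interpolation w u = (1 - frac u) *\<^sub>R w (nat \<lfloor>u\<rfloor>) + frac u *\<^sub>R w (Suc (nat \<lfloor>u\<rfloor>))"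

lemma linear_interpolation_in_convex:
  assumes "convex S" "w (nat \<lfloor>u\<rfloor>) \<in> S" "w (Suc (nat \<lfloor>u\<rfloor>)) \<in> S"
  shows "linear_interpolation w u \<in> S"
  unfolding linear_interpolation_def using assms
  by (intro convexD) (auto simp: frac_ge_0 less_imp_le[OF frac_lt_1])

text \<open>
  On a bounded interval the interpolation is a finite sum of hat functions with vector
  coefficients. This makes continuity evident, also at the integers.
\<close>

lemma linear_interpolation_eq_sum_hats:
  assumes "0 \<le> u" "u < real N"
  shows "linear_interpolation w u = (\<Sum>i\<le>N. max 0 (1 - \<bar>u - real i\<bar>) *\<^sub>R w i)"
proof -
  define n where "n = nat \<lfloor>u\<rfloor>"
  have n: "real n \<le> u" "u < real n + 1"
    using assms(1) by (auto simp: n_def)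
  have fr: "frac u = u - real n"
    using assms(1) by (simp add: frac_def n_def)
  have "n < N"
    using n assms(2) by linarith
  have "(\<Sum>i\<le>N. max 0 (1 - \<bar>u - real i\<bar>) *\<^sub>R w i)
      = (\<Sum>i\<in>{n, Suc n}. max 0 (1 - \<bar>u - real i\<bar>) *\<^sub>R w i)"
  proof (rule sum.mono_neutral_right)
    show "\<forall>i\<in>{..N} - {n, Suc n}. max 0 (1 - \<bar>u - real i\<bar>) *\<^sub>R w i = 0"
    proof
      fix i
      assume "i \<in> {..N} - {n, Suc n}"
      then have "i < n \<or> n + 2 \<le> i"
        by auto
      then have "real i + 1 \<le> real n \<or> real n + 2 \<le> real i"
        by linarith
      then have "1 - \<bar>u - real i\<bar> \<le> 0"
        using n by linarith
      then show "max 0 (1 - \<bar>u - real i\<bar>) *\<^sub>R w i = 0"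
        by simp
    qed
  qed (use \<open>n < N\<close> in auto)
  also have "\<dots> = linear_interpolation w u"
    using n by (simp add: linear_interpolation_def fr flip: n_def)
  finally show ?thesis
    by simp
qed

lemma continuous_on_linear_interpolation:
  fixes w :: "nat \<Rightarrow> 'a::topological_real_vector"
  shows "continuous_on {0..} (linear_interpolation w)"
  unfolding continuous_on_def
proof
  fix u :: real
  assume u: "u \<in> {0..}"
  obtain N where N: "u < real N"
    using reals_Archimedean2 by blast
  let ?hats = "\<lambda>x. \<Sum>i\<le>N. max 0 (1 - \<bar>x - real i\<bar>) *\<^sub>R w i"
  have "(?hats \<longlongrightarrow> ?hats u) (at u within {0..})"
    by (intro tendsto_sum tendsto_scaleR_tvs tendsto_intros)
  moreover have "\<forall>\<^sub>F x in at u within {0..}. linear_interpolation w x = ?hats x"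
  proof -
    have "\<forall>\<^sub>F x in at u within {0..}. x < real N"
      using N by (intro order_tendstoD(2)[OF tendsto_ident_at])
    moreover have "\<forall>\<^sub>F x in at u within {0..}. x \<in> {0::real..}"
      by (simp add: eventually_at_filter)
    ultimately show ?thesis
      by eventually_elim (use linear_interpolation_eq_sum_hats in auto)
  qed
  ultimately show "(linear_interpolation w \<longlongrightarrow> linear_interpolation w u) (at u within {0..})"
    using u N by (simp add: linear_interpolation_eq_sum_hats tendsto_cong)
qed

text \<open>
  Local convexity enters here: a convex neighbourhood of the limit that contains two consecutive
  terms contains the whole segment between them.
\<close>

lemma tendsto_linear_interpolation:
  fixes w :: "nat \<Rightarrow> 'a::locally_convex_vector"
  assumes "w \<longlonglongrightarrow> v"
  shows "(linear_interpolation w \<longlongrightarrow> v) at_top"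
proof (rule topological_tendstoI)
  fix S :: "'a set"
  assume S: "open S" "v \<in> S"
  have "open ((\<lambda>x. v + x) -` S)"
    using S(1) by (intro open_vimage continuous_intros)
  then obtain W where W: "open W" "0 \<in> W" "W \<subseteq> (\<lambda>x. v + x) -` S" "convex W"
    using convex_neighbourhood_base[of "(\<lambda>x. v + x) -` S"] S(2) by auto
  have "(\<lambda>n. w n - v) \<longlonglongrightarrow> v - v"
    by (intro tendsto_diff assms tendsto_const)
  then have "\<forall>\<^sub>F n in sequentially. w n - v \<in> W"
    using W by (auto dest: topological_tendstoD)
  then obtain N where N: "\<And>n. n \<ge> N \<Longrightarrow> w n - v \<in> W"
    by (auto simp: eventually_sequentially)
  have conv: "convex ((\<lambda>x. v + x) ` W)"
    using W(4) by (rule convex_translation)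
  have mem: "w n \<in> (\<lambda>x. v + x) ` W" if "n \<ge> N" for n
    using N[OF that] by (auto intro!: image_eqI[of _ _ "w n - v"])
  have "linear_interpolation w u \<in> S" if "u \<ge> real N" for u
  proof -
    have "nat \<lfloor>u\<rfloor> \<ge> N"
      using that by (simp add: le_nat_floor)
    then have "linear_interpolation w u \<in> (\<lambda>x. v + x) ` W"
      by (intro linear_interpolation_in_convex conv mem) auto
    then show ?thesis
      using W(3) by auto
  qed
  then show "\<forall>\<^sub>F u in at_top. linear_interpolation w u \<in> S"
    by (rule eventually_mono[OF eventually_ge_at_top])
qed

section \<open>Right derivatives of curves and the tangent cone\<close>

lemma right_derivative_in_seq_closure:
  fixes C :: "'a::topological_real_vector set"
  assumes "\<forall>t\<ge>0. c t \<in> C" "c 0 = p" "has_right_derivative_at_0 c v"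
  shows "v \<in> seq_closure_tangent_cone C p"
proof -
  let ?t = "\<lambda>n. inverse (real (Suc n))"
  define w where "w n = (c (?t n) - p) /\<^sub>R ?t n" for n
  have "filterlim ?t (at_right 0) sequentially"
    unfolding filterlim_at using LIMSEQ_inverse_real_of_nat by simp
  then have lim: "w \<longlonglongrightarrow> v"
    using assms(2,3) filterlim_compose unfolding has_right_derivative_at_0_def w_def by blast
  have pw: "p + ?t n *\<^sub>R w n = c (?t n)" for n
    by (simp add: w_def)
  have cone: "w n \<in> tangent_cone C p" for n
    unfolding tangent_cone_def
  proof (intro CollectI exI conjI)
    show "?t n > 0" "p + ?t n *\<^sub>R w n \<in> C"
      using assms(1) by (auto simp: pw simp del: of_nat_Suc)
  qed
  have "\<theta> v \<ge> 0" if \<theta>: "\<theta> \<in> topological_dual" "\<forall>x\<in>C. \<theta> (x - p) \<ge> 0" for \<theta>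
  proof -
    have lin: "linear \<theta>" and cont: "continuous_on UNIV \<theta>"
      using \<theta>(1) by (auto simp: topological_dual_def)
    have "(\<lambda>n. \<theta> (w n)) \<longlonglongrightarrow> \<theta> v"
      using continuous_on_tendsto_compose[OF cont lim] by simp
    moreover have "\<theta> (w n) \<ge> 0" for n
      using \<theta>(2) assms(1) by (simp add: w_def linear_cmul[OF lin] del: of_nat_Suc)
    ultimately show ?thesis
      by (intro LIMSEQ_le_const) auto
  qed
  with lim cone show ?thesis
    by (auto simp: seq_closure_tangent_cone_def solid_tangent_cone_def)
qed

text \<open>
  The indices are read off at \<open>1 / t - 1\<close> because then \<open>t \<le> 1 / (n + 1)\<close> for
  \<open>n = \<lfloor>1 / t - 1\<rfloor>\<close>, which is within the admissible time of both \<open>w n\<close> and \<open>w (n + 1)\<close>.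
  After time \<open>1\<close> the curve rests.
\<close>

lemma curve_through_admissible_directions:
  fixes C :: "'a::locally_convex_vector set"
  assumes "convex C" and lim: "w \<longlonglongrightarrow> v" and adm: "\<And>n. w n \<in> admissible_directions C p n"
  obtains c where "continuous_on {0..} c" "\<And>t. t \<ge> 0 \<Longrightarrow> c t \<in> C" "c 0 = p"
    "has_right_derivative_at_0 c v"
proof
  define \<omega> where "\<omega> t = linear_interpolation w (1 / min t 1 - 1)" for t
  define c where "c t = p + min t 1 *\<^sub>R \<omega> t" for t :: real
  show c0: "c 0 = p"
    by (simp add: c_def)

  have "filterlim (\<lambda>t::real. -1 + inverse t) at_top (at_right 0)"
    by (rule filterlim_tendsto_add_at_top[OF tendsto_const filterlim_inverse_at_top_right])
  then have "((\<lambda>t. linear_interpolation w (-1 + inverse t)) \<longlongrightarrow> v) (at_right 0)"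
    by (rule filterlim_compose[OF tendsto_linear_interpolation[OF lim]])
  moreover have small: "\<forall>\<^sub>F t::real in at_right 0. 0 < t \<and> t < 1"
    using eventually_at_right_real[of 0 1] by simp
  then have "\<forall>\<^sub>F t in at_right 0. linear_interpolation w (-1 + inverse t) = \<omega> t"
    by eventually_elim (simp add: \<omega>_def inverse_eq_divide)
  ultimately have \<omega>_lim: "(\<omega> \<longlongrightarrow> v) (at_right 0)"
    by (simp add: tendsto_cong)

  have "\<forall>\<^sub>F t in at_right 0. \<omega> t = (c t - c 0) /\<^sub>R t"
    using small by eventually_elim (simp add: c0, simp add: c_def)
  with \<omega>_lim show "has_right_derivative_at_0 c v"
    unfolding has_right_derivative_at_0_def by (simp add: tendsto_cong)

  have "((\<lambda>t. p + min t 1 *\<^sub>R \<omega> t) \<longlongrightarrow> p + min 0 1 *\<^sub>R v) (at_right 0)"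
    by (intro tendsto_intros tendsto_scaleR_tvs \<omega>_lim)
  then have cont0: "(c \<longlongrightarrow> c 0) (at 0 within {0..})"
    by (simp add: c0 at_within_Ici_at_right flip: c_def)
  have "continuous_on {0<..} \<omega>"
    unfolding \<omega>_def
    by (rule continuous_on_compose2[OF continuous_on_linear_interpolation])
      (auto intro!: continuous_intros simp: field_simps)
  then have "continuous_on {0<..} c"
    unfolding c_def by (intro continuous_intros continuous_on_scaleR_tvs)
  then have "(c \<longlongrightarrow> c t) (at t within {0..})" if "t > 0" for t
    using that by (auto simp: continuous_on_eq_continuous_at isCont_def
        intro: tendsto_within_subset)
  with cont0 show "continuous_on {0..} c"
    unfolding continuous_on_def by (metis atLeast_iff less_eq_real_def)

  show "c t \<in> C" if "t \<ge> 0" for t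
  proof (cases "t = 0")
    case True
    then show ?thesis
      using adm[of 0] by (auto simp: c0 admissible_directions_def dest: spec[of _ 0])
  next
    case False
    define s where "s = min t 1"
    have s: "0 < s" "s \<le> 1"
      using False that by (auto simp: s_def)
    define n where "n = nat \<lfloor>1 / s - 1\<rfloor>"
    have "real n \<le> 1 / s - 1"
      using s by (simp add: n_def)
    then have "s * real (Suc n) \<le> 1"
      using s by (simp add: field_simps)
    moreover from this have "s * real n \<le> 1"
      using s by (simp add: algebra_simps)
    ultimately have "p + s *\<^sub>R w n \<in> C" "p + s *\<^sub>R w (Suc n) \<in> C"
      using adm[of n] adm[of "Suc n"] s by (auto simp: admissible_directions_def)
    moreover have "convex ((\<lambda>x. p + s *\<^sub>R x) -` C)"
    proof -
      have "(\<lambda>x. p + s *\<^sub>R x) -` C = (\<lambda>x. s *\<^sub>R x) -` ((\<lambda>x. p + x) -` C)"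
        by auto
      moreover have "(\<lambda>x. p + x) -` C = (\<lambda>x. - p + x) ` C"
        by (auto intro!: image_eqI[of _ _ "p + _"])
      ultimately show ?thesis
        using assms(1) by (simp only:)
          (intro convex_linear_vimage convex_translation linear_scale_self)
    qed
    ultimately have "linear_interpolation w (1 / s - 1) \<in> (\<lambda>x. p + s *\<^sub>R x) -` C"
      by (intro linear_interpolation_in_convex) (auto simp: n_def)
    then show ?thesis
      by (simp add: c_def \<omega>_def s_def)
  qed
qed

theorem theorem1:
  fixes C :: "'a::locally_convex_vector set" and p v :: 'a
  assumes "closed C" and "convex C" and "p \<in> C"
  shows "(\<exists>c :: real \<Rightarrow> 'a. continuous_on {0..} c \<and> (\<forall>t\<ge>0. c t \<in> C) \<and> c 0 = p \<and>
            has_right_derivative_at_0 c v)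
         \<longleftrightarrow> v \<in> seq_closure_tangent_cone C p"
proof
  assume "\<exists>c :: real \<Rightarrow> 'a. continuous_on {0..} c \<and> (\<forall>t\<ge>0. c t \<in> C) \<and> c 0 = p \<and>
            has_right_derivative_at_0 c v"
  then show "v \<in> seq_closure_tangent_cone C p"
    using right_derivative_in_seq_closure by blast
next
  assume "v \<in> seq_closure_tangent_cone C p"
  then obtain w where cone: "\<And>n. w n \<in> tangent_cone C p" and lim: "w \<longlonglongrightarrow> v"
    by (auto simp: seq_closure_tangent_cone_def)
  \<comment> \<open>The zero vector is admissible at all times; it serves until a term of \<open>w\<close> becomes admissible.\<close>
  define x where "x = case_nat 0 w"
  have x_lim: "x \<longlonglongrightarrow> v"
    using lim by (subst filterlim_sequentially_Suc[symmetric]) (simp add: x_def)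
  have zero: "x 0 \<in> admissible_directions C p n" for n
    using assms(3) by (simp add: x_def admissible_directions_def)
  have ev: "\<forall>\<^sub>F n in sequentially. x k \<in> admissible_directions C p n" for k
  proof (cases k)
    case 0
    then show ?thesis using zero by simp
  next
    case (Suc j)
    then show ?thesis using eventually_admissible[OF assms(2,3) cone[of j]] by (simp add: x_def)
  qed
  obtain f where f: "filterlim f at_top sequentially" "\<And>n. x (f n) \<in> admissible_directions C p n"
    using delayed_sequence[of "\<lambda>k n. x k \<in> admissible_directions C p n", OF ev zero] by blast
  have "(\<lambda>n. x (f n)) \<longlonglongrightarrow> v"
    using x_lim f(1) by (rule filterlim_compose)
  then obtain c where "continuous_on {0..} c" "\<And>t. t \<ge> 0 \<Longrightarrow> c t \<in> C" "c 0 = p"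
    "has_right_derivative_at_0 c v"
    using curve_through_admissible_directions[OF assms(2) _ f(2)] by blast
  then show "\<exists>c :: real \<Rightarrow> 'a. continuous_on {0..} c \<and> (\<forall>t\<ge>0. c t \<in> C) \<and> c 0 = p \<and>
            has_right_derivative_at_0 c v"
    by blast
qed

end
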